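(* Say that $\mu$ fixes setwise an $\mathbb{F}_q$-plane $\mathcal B\in\mathrm{orb}(\mathsf S_T)$ if all points and lines of $\mathcal B$ have Type III, $\{P^\phi P^{\phi^2}: P\text{ a point of }\mathcal B\}$ equals the set of lines of $\mathcal B$, and $\{\ell^\phi\cap\ell^{\phi^2}:\ell\text{ a line of }\mathcal B\}$ equals the set of points of $\mathcal B$. Then: (1) if $\gcd(3,q-1)=1$, $\mu$ fixes setwise no $\mathbb{F}_q$-plane of $\mathrm{orb}(\mathsf S_T)$; (2) if $\gcd(3,q-1)=3$, $\mu$ fixes setwise exactly two $\mathbb{F}_q$-planes of $\mathrm{orb}(\mathsf S_T)$, namely $\pi_\lambda=\{(x,x^q,\lambda x^{q^2}):x\in\mathbb{F}_{q^3}^*\}$ for $\lambda\in\mathbb{F}_q$ with $\lambda^3=1$, $\lambda\neq1$.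
   Context: Let $q$ be a prime power, $\mathbb{F}_{q^3}^*=\mathbb{F}_{q^3}\setminus\{0\}$. Points of $\mathrm{PG}(2,q^3)$ have homogeneous coordinates $(x,y,z)$ and lines $[a,b,c]$. An $\mathbb{F}_q$-plane is a subplane of order $q$; its lines are those meeting it in $q+1$ points. Let $\phi$ be the collineation $(x,y,z)\mapsto(z^q,x^q,y^q)$ (on lines $[d,e,f]\mapsto[f^q,d^q,e^q]$), with fixed points $\mathcal P_{2,q}=\{(x,x^q,x^{q^2}):x\in\mathbb{F}_{q^3}^*\}$. A point has Type III if its $\phi$-orbit is three non-collinear points; a line has Type III if its $\phi$-orbit is three non-concurrent lines. The map $\mu$ sends a Type III point $P$ to the line $P^\phi P^{\phi^2}$ and a Type III line $\ell$ to the point $\ell^\phi\cap\ell^{\phi^2}$. Let $\psi_t:(x,y,z)\mapsto(tx,t^qy,t^{q^2}z)$ for $t\in\mathbb{F}_{q^3}^*$, $\mathsf S_T=\{\psi_t\}$, and $\mathrm{orb}(\mathsf S_T)$ the set of point orbits of $\mathsf S_T$. *)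

theory Defs
  imports Main "HOL-Computational_Algebra.Primes"
begin

text \<open>Homogeneous coordinates over a finite field 'a (playing the role of F_{q^3}).
  Points and lines of PG(2,q^3) are both represented as classes of nonzero
  coordinate triples modulo nonzero scalars; a point class P and a line class l
  are incident iff a x + b y + c z = 0 for representatives.\<close>

type_synonym 'a vec3 = "'a \<times> 'a \<times> 'a"

fun smul3 :: "'a::field \<Rightarrow> 'a vec3 \<Rightarrow> 'a vec3" where
  "smul3 c (x, y, z) = (c * x, c * y, c * z)"

definition cls :: "'a::field vec3 \<Rightarrow> 'a vec3 set" where
  "cls v = {smul3 c v | c. c \<noteq> 0}"

definition PG :: "'a::field vec3 set set" where
  "PG = {cls v | v. v \<noteq> (0, 0, 0)}"

fun dot3 :: "'a::field vec3 \<Rightarrow> 'a vec3 \<Rightarrow> 'a" where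
  "dot3 (a, b, c) (x, y, z) = a * x + b * y + c * z"

definition incident :: "'a::field vec3 set \<Rightarrow> 'a vec3 set \<Rightarrow> bool" where
  "incident P l \<longleftrightarrow> (\<exists>v\<in>P. \<exists>w\<in>l. dot3 w v = 0)"

text \<open>The collineation phi: (x,y,z) maps to (z^q,x^q,y^q); on lines [d,e,f] maps to [f^q,d^q,e^q]
  (same formula).\<close>
fun phiv :: "nat \<Rightarrow> 'a::field vec3 \<Rightarrow> 'a vec3" where
  "phiv q (x, y, z) = (z ^ q, x ^ q, y ^ q)"

definition phi :: "nat \<Rightarrow> 'a::field vec3 set \<Rightarrow> 'a vec3 set" where
  "phi q P = phiv q ` P"

definition collinear3 :: "'a::field vec3 set \<Rightarrow> 'a vec3 set \<Rightarrow> 'a vec3 set \<Rightarrow> bool" where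
  "collinear3 P Q R \<longleftrightarrow> (\<exists>l\<in>PG. incident P l \<and> incident Q l \<and> incident R l)"

definition concurrent3 :: "'a::field vec3 set \<Rightarrow> 'a vec3 set \<Rightarrow> 'a vec3 set \<Rightarrow> bool" where
  "concurrent3 l m n \<longleftrightarrow> (\<exists>P\<in>PG. incident P l \<and> incident P m \<and> incident P n)"

definition typeIII_pt :: "nat \<Rightarrow> 'a::field vec3 set \<Rightarrow> bool" where
  "typeIII_pt q P \<longleftrightarrow> P \<in> PG \<and> \<not> collinear3 P (phi q P) (phi q (phi q P))"

definition typeIII_line :: "nat \<Rightarrow> 'a::field vec3 set \<Rightarrow> bool" where
  "typeIII_line q l \<longleftrightarrow> l \<in> PG \<and> \<not> concurrent3 l (phi q l) (phi q (phi q l))"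

definition mu_pt :: "nat \<Rightarrow> 'a::field vec3 set \<Rightarrow> 'a vec3 set" where
  "mu_pt q P = (THE l. l \<in> PG \<and> incident (phi q P) l \<and> incident (phi q (phi q P)) l)"

definition mu_line :: "nat \<Rightarrow> 'a::field vec3 set \<Rightarrow> 'a vec3 set" where
  "mu_line q l = (THE P. P \<in> PG \<and> incident P (phi q l) \<and> incident P (phi q (phi q l)))"

definition lines_of :: "nat \<Rightarrow> 'a::field vec3 set set \<Rightarrow> 'a vec3 set set" where
  "lines_of q B = {l \<in> PG. card {P \<in> B. incident P l} = q + 1}"

text \<open>F_q-plane: subplane of order q, i.e. B together with the lines meeting it in at least
  two points is a projective plane (two lines meet in B, there is a quadrangle) whose lines
  carry q+1 points of B.\<close>
definition Fq_plane :: "nat \<Rightarrow> 'a::field vec3 set set \<Rightarrow> bool" where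
  "Fq_plane q B \<longleftrightarrow> B \<subseteq> PG
     \<and> (\<forall>l\<in>PG. card {P \<in> B. incident P l} \<ge> 2 \<longrightarrow> card {P \<in> B. incident P l} = q + 1)
     \<and> (\<forall>l\<in>PG. \<forall>m\<in>PG. l \<noteq> m \<and> card {P \<in> B. incident P l} \<ge> 2 \<and> card {P \<in> B. incident P m} \<ge> 2
          \<longrightarrow> (\<exists>P\<in>B. incident P l \<and> incident P m))
     \<and> (\<exists>P1\<in>B. \<exists>P2\<in>B. \<exists>P3\<in>B. \<exists>P4\<in>B. distinct [P1, P2, P3, P4]
          \<and> \<not> collinear3 P1 P2 P3 \<and> \<not> collinear3 P1 P2 P4
          \<and> \<not> collinear3 P1 P3 P4 \<and> \<not> collinear3 P2 P3 P4)"

fun psiv :: "nat \<Rightarrow> 'a::field \<Rightarrow> 'a vec3 \<Rightarrow> 'a vec3" where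
  "psiv q t (x, y, z) = (t * x, t ^ q * y, t ^ (q ^ 2) * z)"

definition psi :: "nat \<Rightarrow> 'a::field \<Rightarrow> 'a vec3 set \<Rightarrow> 'a vec3 set" where
  "psi q t P = psiv q t ` P"

definition orbS :: "nat \<Rightarrow> 'a::field vec3 set set set" where
  "orbS q = {{psi q t P | t. t \<noteq> 0} | P. P \<in> PG}"

definition mu_fixes :: "nat \<Rightarrow> 'a::field vec3 set set \<Rightarrow> bool" where
  "mu_fixes q B \<longleftrightarrow> (\<forall>P\<in>B. typeIII_pt q P) \<and> (\<forall>l\<in>lines_of q B. typeIII_line q l)
     \<and> mu_pt q ` B = lines_of q B \<and> mu_line q ` lines_of q B = B"

definition pi_lam :: "nat \<Rightarrow> 'a::field \<Rightarrow> 'a vec3 set set" where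
  "pi_lam q lam = {cls (x, x ^ q, lam * x ^ (q ^ 2)) | x. x \<noteq> 0}"

end

theory Submission
  imports Defs "HOL-Computational_Algebra.Polynomial" "HOL-Number_Theory.Cong"
begin

text \<open>
  An orbit that is a plane consists of the points (x, b x^q, g x^(q^2)) with b, g nonzero. A linear
  form vanishing at two of them is proportional to a twisted trace form, so the lines of the orbit
  are the (u, u^q / b, u^(q^2) / g), and mu on its lines is mu on points with b, g inverted.
  Put e = b^q g^(q^2) and let B, C be the norms of b and g. Evaluating mu at x = 1, the orbit can be
  fixed only if (1 - e, B - e^(q^2), C - e^q) is proportional to some (w, w^q, w^(q^2)) with w
  nonzero; by duality the same holds for 1 / e, 1 / B, 1 / C. Dividing the resulting equations
  gives e^3 = B^3 = C^3 = 1. If 3 does not divide q - 1 this forces e = 1, which is excluded.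
  Otherwise e lies in the fixed field, so B C = e^3 = 1 and B, C differ from e, which leaves
  B = C = 1; Hilbert 90 then normalises b to 1 and turns g into e.
\<close>

section \<open>Points and lines in homogeneous coordinates\<close>

fun cross :: "'a::field vec3 \<Rightarrow> 'a vec3 \<Rightarrow> 'a vec3" where
  "cross (a, b, c) (d, e, f) = (b * f - c * e, c * d - a * f, a * e - b * d)"

lemma in_cls: "v \<in> cls v"
  by (cases v) (auto simp: cls_def intro!: exI[of _ 1])

lemma cls_eq_iff: "cls v = cls w \<longleftrightarrow> (\<exists>c. c \<noteq> 0 \<and> w = smul3 c v)"
proof
  assume "cls v = cls w"
  then have "w \<in> cls v" using in_cls[of w] by simp
  then show "\<exists>c. c \<noteq> 0 \<and> w = smul3 c v"
    unfolding cls_def by blast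
next
  assume "\<exists>c. c \<noteq> 0 \<and> w = smul3 c v"
  then obtain c where c: "c \<noteq> 0" "w = smul3 c v" by blast
  have "smul3 d v = smul3 (d / c) w" "smul3 d w = smul3 (d * c) v" for d
    using c by (cases v; simp)+
  moreover have "d / c \<noteq> 0" "d * c \<noteq> 0" if "d \<noteq> 0" for d
    using that c(1) by simp_all
  ultimately show "cls v = cls w"
    unfolding cls_def by blast
qed

lemma incident_cls [simp]: "incident (cls v) (cls w) \<longleftrightarrow> dot3 w v = 0"
proof -
  have *: "dot3 (smul3 c w) (smul3 d v) = c * d * dot3 w v" for c d
    by (cases v; cases w) (simp add: algebra_simps)
  show ?thesis
  proof
    assume "incident (cls v) (cls w)"
    then obtain c d where "c \<noteq> 0" "d \<noteq> 0" "dot3 (smul3 c w) (smul3 d v) = 0"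
      unfolding incident_def cls_def by blast
    then show "dot3 w v = 0" by (simp add: *)
  next
    assume "dot3 w v = 0"
    then show "incident (cls v) (cls w)"
      unfolding incident_def using in_cls by blast
  qed
qed

lemma incident_commute: "incident P l \<longleftrightarrow> incident l P"
proof -
  have "dot3 w v = dot3 v w" for v w :: "'a vec3"
    by (cases v; cases w) (simp add: algebra_simps)
  then show ?thesis
    unfolding incident_def by metis
qed

text \<open>\<open>phi\<close> has the same formula on points and on lines and incidence is
  symmetric, so results on points carry over to lines.\<close>

lemma typeIII_line_eq_pt: "typeIII_line = typeIII_pt"
  by (intro ext) (simp add: typeIII_line_def typeIII_pt_def concurrent3_def collinear3_def incident_commute)

lemma mu_line_eq_pt: "mu_line = mu_pt"
  by (intro ext) (simp add: mu_line_def mu_pt_def incident_commute)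

lemma cls_in_PG_iff [simp]: "cls v \<in> PG \<longleftrightarrow> v \<noteq> (0, 0, 0)"
proof -
  have "smul3 c v = (0, 0, 0) \<longleftrightarrow> v = (0, 0, 0)" if "c \<noteq> 0" for c
    using that by (cases v) auto
  then have "v \<noteq> (0, 0, 0)" if "cls v = cls w" "w \<noteq> (0, 0, 0)" for w
    using that unfolding cls_eq_iff by metis
  then show ?thesis
    unfolding PG_def by blast
qed

lemma PG_cases:
  assumes "l \<in> PG"
  obtains a b c where "l = cls (a, b, c)" "(a, b, c) \<noteq> (0, 0, 0)"
  using assms unfolding PG_def by auto

lemma dot3_cross: "dot3 (cross v w) v = 0" "dot3 (cross v w) w = 0"
  by (cases v; cases w; simp add: algebra_simps)+

text \<open>The cross product of \<open>l\<close> with \<open>cross v w\<close> is a combination of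
  \<open>v\<close> and \<open>w\<close> with coefficients \<open>dot3 l w\<close> and
  \<open>- dot3 l v\<close>, hence zero. So the 2 x 2 minors of \<open>l\<close> and
  \<open>cross v w\<close> vanish.\<close>

lemma cls_eq_cross:
  assumes "dot3 l v = 0" "dot3 l w = 0" "l \<noteq> (0, 0, 0)" "cross v w \<noteq> (0, 0, 0)"
  shows "cls l = cls (cross v w)"
proof -
  obtain n1 n2 n3 where n: "cross v w = (n1, n2, n3)" by (cases "cross v w")
  obtain l1 l2 l3 where l: "l = (l1, l2, l3)" by (cases l)
  have p: "l1 * n2 = l2 * n1" "l1 * n3 = l3 * n1" "l2 * n3 = l3 * n2"
  proof -
    obtain a b c d e f where vw: "v = (a, b, c)" "w = (d, e, f)" by (cases v; cases w)
    have "l1 * a + l2 * b + l3 * c = 0" "l1 * d + l2 * e + l3 * f = 0"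
      "n1 = b * f - c * e" "n2 = c * d - a * f" "n3 = a * e - b * d"
      using assms(1,2) n by (auto simp: l vw)
    then show "l1 * n2 = l2 * n1" "l1 * n3 = l3 * n1" "l2 * n3 = l3 * n2"
      by algebra+
  qed
  have "\<exists>c. c \<noteq> 0 \<and> (n1, n2, n3) = smul3 c (l1, l2, l3)"
  proof -
    consider "l1 \<noteq> 0" | "l2 \<noteq> 0" | "l3 \<noteq> 0" using assms(3) l by auto
    then show ?thesis
    proof cases
      case 1
      then show ?thesis using p assms(4) n by (intro exI[of _ "n1 / l1"]) (auto simp: field_simps)
    next
      case 2
      then show ?thesis using p assms(4) n by (intro exI[of _ "n2 / l2"]) (auto simp: field_simps)
    next
      case 3
      then show ?thesis using p assms(4) n by (intro exI[of _ "n3 / l3"]) (auto simp: field_simps)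
    qed
  qed
  then show ?thesis by (simp add: cls_eq_iff n l)
qed

section \<open>Images and fibres of maps\<close>

lemma image_Compl_0:
  fixes f :: "'a::zero \<Rightarrow> 'a"
  assumes "\<And>x. x \<noteq> 0 \<Longrightarrow> f x \<noteq> 0" "\<And>x. x \<noteq> 0 \<Longrightarrow> g x \<noteq> 0 \<and> f (g x) = x"
  shows "f ` (- {0}) = - {0}"
proof
  show "- {0} \<subseteq> f ` (- {0})"
  proof
    fix x :: 'a assume "x \<in> - {0}"
    then show "x \<in> f ` (- {0})"
      using assms(2)[of x] by (intro image_eqI[of _ _ "g x"]) auto
  qed
  show "f ` (- {0}) \<subseteq> - {0}"
  proof (rule image_subsetI)
    fix x :: 'a assume "x \<in> - {0}"
    then show "f x \<in> - {0}" using assms(1)[of x] by simp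
  qed
qed

lemma card_eq_card_image_times_fibre:
  assumes "finite A" "\<And>y. y \<in> A \<Longrightarrow> card {x \<in> A. f x = f y} = m"
  shows "card A = card (f ` A) * m"
proof -
  have "card A = (\<Sum>x\<in>A. 1)" by simp
  also have "\<dots> = (\<Sum>y\<in>f ` A. \<Sum>x\<in>{x \<in> A. f x = y}. 1)"
    by (rule sum.image_gen[OF assms(1)])
  also have "\<dots> = (\<Sum>y\<in>f ` A. m)"
    by (rule sum.cong) (auto simp: assms(2))
  finally show ?thesis by simp
qed

text \<open>Each fibre is a translate of the kernel.\<close>

lemma card_UNIV_additive:
  fixes f :: "'a::{ab_group_add,finite} \<Rightarrow> 'b::ab_group_add"
  assumes "\<And>x y. f (x + y) = f x + f y"
  shows "card (UNIV :: 'a set) = card (range f) * card {x. f x = 0}"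
proof (rule card_eq_card_image_times_fibre)
  fix y :: 'a
  have diff: "f (x - y) = f x - f y" for x
    using assms[of "x - y" y] by simp
  have "bij_betw (\<lambda>x. x + y) {x. f x = 0} {x \<in> UNIV. f x = f y}"
    by (rule bij_betw_byWitness[where f' = "\<lambda>x. x - y"]) (auto simp: assms diff)
  then show "card {x \<in> UNIV. f x = f y} = card {x. f x = 0}"
    by (simp add: bij_betw_same_card)
qed simp

lemma two_le_cardE:
  assumes "2 \<le> card A"
  obtains x y where "x \<in> A" "y \<in> A" "x \<noteq> y"
proof -
  \<comment> \<open>An infinite set would have \<open>card\<close> equal to 0.\<close>
  have "finite A" using assms card.infinite by fastforce
  then show ?thesis using assms that card_le_Suc0_iff_eq[of A] by fastforce
qed

section \<open>Multiplicative order and characteristic of a finite field\<close>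

text \<open>Multiplication by \<open>x\<close> permutes the nonzero elements, so the factor it
  contributes to their product is 1.\<close>

lemma finite_field_power_card_minus_one:
  fixes x :: "'a::{field,finite}"
  assumes "x \<noteq> 0"
  shows "x ^ (card (UNIV :: 'a set) - 1) = 1"
proof -
  have "prod ((*) x) (- {0}) = \<Prod>(- {0})"
    by (rule prod.reindex_bij_witness[of _ "\<lambda>y. y / x" "(*) x"]) (use assms in auto)
  then have "x ^ card (- {0 :: 'a}) * \<Prod>(- {0}) = \<Prod>(- {0})"
    by (simp add: prod.distrib)
  then show ?thesis by (simp add: Compl_eq_Diff_UNIV)
qed

text \<open>Translation by 1 permutes the field, so summing all elements shows that
  \<open>p ^ n\<close> copies of 1 add up to 0.\<close>

lemma CHAR_eq_if_card_eq_prime_power: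
  assumes "prime p" "card (UNIV :: 'a::{field,finite} set) = p ^ n"
  shows "CHAR('a) = p"
proof -
  have "prime CHAR('a)"
    by (intro prime_CHAR_semidom finite_imp_CHAR_pos) simp
  moreover have "(\<Sum>x\<in>(UNIV :: 'a set). x + 1) = (\<Sum>x\<in>UNIV. x)"
    by (rule sum.reindex_bij_witness[of _ "\<lambda>x. x - 1" "\<lambda>x. x + 1"]) auto
  then have "CHAR('a) dvd p ^ n"
    using assms(2) by (simp add: sum.distrib flip: of_nat_eq_0_iff_char_dvd)
  ultimately show ?thesis
    using assms(1) prime_dvd_power primes_dvd_imp_eq by blast
qed

section \<open>The cubic extension and its Frobenius map\<close>

text \<open>\<open>s\<close> is the Frobenius map \<open>x ^ q\<close>; a separate symbol with
  \<open>s_s_s\<close> keeps large exponents out of the calculations.\<close>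

locale cubic_frobenius =
  fixes q :: nat and s :: "'a::{field,finite} \<Rightarrow> 'a"
  assumes s_eq: "s x = x ^ q"
    and s_add: "s (x + y) = s x + s y"
    and s_s_s [simp]: "s (s (s x)) = x"
    and card_UNIV: "card (UNIV :: 'a set) = q ^ 3"
    and q_ge_2: "2 \<le> q"
begin

lemma s_mult: "s (x * y) = s x * s y"
  by (simp add: s_eq power_mult_distrib)

lemma s_0 [simp]: "s 0 = 0"
  using q_ge_2 by (simp add: s_eq)

lemma s_1 [simp]: "s 1 = 1"
  by (simp add: s_eq)

lemma s_eq_iff [simp]: "s x = s y \<longleftrightarrow> x = y"
  by (metis s_s_s)

lemma s_eq_0_iff [simp]: "s x = 0 \<longleftrightarrow> x = 0"
  by (metis s_0 s_s_s)

lemma s_diff: "s (x - y) = s x - s y"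
  by (metis add_diff_cancel diff_add_cancel s_add)

lemma s_divide: "s (x / y) = s x / s y"
  by (simp add: s_eq power_divide)

lemma s_power: "s (x ^ n) = s x ^ n"
  by (simp add: s_eq mult.commute flip: power_mult)

lemmas s_hom = s_add s_diff s_mult s_divide s_power

lemma power_q2: "x ^ (q ^ 2) = s (s x)"
  by (simp add: s_eq power2_eq_square power_mult)

definition trace :: "'a \<Rightarrow> 'a" where
  "trace x = x + s x + s (s x)"

lemma trace_add: "trace (x + y) = trace x + trace y"
  by (simp add: trace_def s_add)

lemma s_trace: "s (trace x) = trace x"
  by (simp add: trace_def s_add algebra_simps)

lemma trace_mult_fixed: "s t = t \<Longrightarrow> trace (t * x) = t * trace x"
  by (simp add: trace_def s_mult algebra_simps)

text \<open>Counting roots bounds both cardinalities from above. The trace takes fixed values, so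
  counting image and kernel makes the product at least \<open>q ^ 3\<close>, and both bounds are
  attained.\<close>

lemma card_fixed_and_card_trace_kernel:
  shows card_fixed: "card {t. s t = t} = q"
    and card_trace_kernel: "card {x. trace x = 0} = q\<^sup>2"
proof -
  have q: "q \<noteq> 0" "q \<noteq> 1" "q < q\<^sup>2" "1 < q\<^sup>2" "0 < q"
    using q_ge_2 mult_le_mono[OF q_ge_2 q_ge_2] by (auto simp: power2_eq_square)
  have f: "card {t. s t = t} \<le> q"
  proof -
    define f :: "'a poly" where "f = monom 1 q - monom 1 1"
    have "coeff f q = 1" using q by (simp add: f_def)
    moreover have "degree f \<le> q"
      using q by (auto simp: f_def intro!: degree_diff_le degree_monom_le order_trans[OF degree_monom_le])
    moreover have "{t. s t = t} = {x. poly f x = 0}"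
      by (auto simp: f_def poly_monom s_eq)
    ultimately show ?thesis
      using card_poly_roots_bound[of f] by fastforce
  qed
  have k: "card {x. trace x = 0} \<le> q\<^sup>2"
  proof -
    define f :: "'a poly" where "f = monom 1 1 + monom 1 q + monom 1 (q\<^sup>2)"
    have "coeff f (q\<^sup>2) = 1" using q by (simp add: f_def)
    moreover have "degree f \<le> q\<^sup>2"
      using q by (auto simp: f_def intro!: degree_add_le order_trans[OF degree_monom_le])
    moreover have "{x. trace x = 0} = {x. poly f x = 0}"
      by (auto simp: f_def poly_monom trace_def power_q2) (auto simp: s_eq)
    ultimately show ?thesis
      using card_poly_roots_bound[of f] by fastforce
  qed
  have "q ^ 3 = card (range trace) * card {x. trace x = 0}"
    using card_UNIV_additive[of trace] trace_add card_UNIV by simp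
  also have "\<dots> \<le> card {t. s t = t} * card {x. trace x = 0}"
    by (intro mult_right_mono card_mono) (auto simp: s_trace)
  finally have le: "q * q\<^sup>2 \<le> card {t. s t = t} * card {x. trace x = 0}"
    by (simp add: power3_eq_cube power2_eq_square)
  have "q * q\<^sup>2 \<le> card {t. s t = t} * q\<^sup>2"
    using le k by (meson le_trans mult_le_mono2)
  with f q show "card {t. s t = t} = q" by simp
  with le k q show "card {x. trace x = 0} = q\<^sup>2" by simp
qed

lemma ex_trace_ne_0: "\<exists>x. trace x \<noteq> 0"
proof (rule ccontr)
  assume "\<not> ?thesis"
  then have "q ^ 3 = q\<^sup>2" using card_trace_kernel card_UNIV by simp
  then show False using q_ge_2 by (simp add: power3_eq_cube power2_eq_square)
qed

lemma ex_not_fixed: "\<exists>x. s x \<noteq> x"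
proof (rule ccontr)
  assume "\<not> ?thesis"
  then have "q ^ 3 = q" using card_fixed card_UNIV by simp
  then show False using q_ge_2 by (simp add: power3_eq_cube)
qed

text \<open>Otherwise a nonzero polynomial of degree at most \<open>q ^ 2\<close> would have
  \<open>q ^ 3\<close> roots.\<close>

lemma linear_comb_ne_0:
  assumes "c \<noteq> 0"
  shows "\<exists>x. a * x + b * s x + c * s (s x) \<noteq> 0"
proof (rule ccontr)
  assume *: "\<not> ?thesis"
  have q: "q \<noteq> 0" "q \<noteq> 1" "q < q\<^sup>2" "1 < q\<^sup>2" "0 < q"
    using q_ge_2 mult_le_mono[OF q_ge_2 q_ge_2] by (auto simp: power2_eq_square)
  define f :: "'a poly" where "f = monom a 1 + monom b q + monom c (q\<^sup>2)"
  have "coeff f (q\<^sup>2) = c" using q by (simp add: f_def)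
  moreover have "degree f \<le> q\<^sup>2"
    using q by (auto simp: f_def intro!: degree_add_le order_trans[OF degree_monom_le])
  moreover have "UNIV = {x. poly f x = 0}"
    using * by (auto simp: f_def poly_monom power_q2) (auto simp: s_eq)
  ultimately have "q ^ 3 \<le> q\<^sup>2"
    using card_poly_roots_bound[of f] assms by (fastforce simp flip: card_UNIV)
  then show False using q_ge_2 by (simp add: power3_eq_cube power2_eq_square)
qed

text \<open>Hilbert 90, by Lagrange resolvents.\<close>
lemma norm_1_imp_quotient:
  assumes "b * s b * s (s b) = 1"
  shows "\<exists>x. x \<noteq> 0 \<and> b * s x = x"
proof -
  have "b \<noteq> 0" using assms by auto
  then obtain y where y: "1 * y + b * s y + b * s b * s (s y) \<noteq> 0"
    using linear_comb_ne_0[of "b * s b" 1 b] by auto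
  \<comment> \<open>Applying \<open>s\<close> and multiplying by \<open>b\<close> shifts the three
    terms cyclically; the last one returns to \<open>y\<close> because \<open>b\<close> has norm
    1.\<close>
  have "b * s (1 * y + b * s y + b * s b * s (s y)) = 1 * y + b * s y + b * s b * s (s y)"
    using assms by (simp add: s_hom algebra_simps)
  with y show ?thesis by blast
qed

section \<open>Torus orbits as subplanes\<close>

text \<open>The image of the point (1, b, g) under \<open>psi q x\<close>, so that
  \<open>pl b g\<close> is a torus orbit. Lines are written in the same form.\<close>

definition pt :: "'a \<Rightarrow> 'a \<Rightarrow> 'a \<Rightarrow> 'a vec3 set" where
  "pt b g x = cls (x, b * s x, g * s (s x))"

definition pl :: "'a \<Rightarrow> 'a \<Rightarrow> 'a vec3 set set" where
  "pl b g = pt b g ` (- {0})"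

lemma pl_cases:
  assumes "P \<in> pl b g"
  obtains x where "x \<noteq> 0" "P = pt b g x"
  using assms by (auto simp only: pl_def image_iff Compl_iff singleton_iff)

lemma pt_in_pl: "x \<noteq> 0 \<Longrightarrow> pt b g x \<in> pl b g"
  by (simp add: pl_def)

lemma pt_in_PG: "x \<noteq> 0 \<Longrightarrow> pt b g x \<in> PG"
  by (simp add: pt_def)

text \<open>The first coordinate shows that the scalar is \<open>y / x\<close>, and the second that
  \<open>s\<close> fixes it.\<close>

lemma pt_eq_iff:
  assumes "b \<noteq> 0" "g \<noteq> 0" "x \<noteq> 0" "y \<noteq> 0"
  shows "pt b g x = pt b g y \<longleftrightarrow> (\<exists>t. t \<noteq> 0 \<and> s t = t \<and> y = t * x)"
  unfolding pt_def cls_eq_iff using assms by (auto simp: s_mult; fastforce)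

lemma pt_eq_iff_cross:
  assumes "b \<noteq> 0" "g \<noteq> 0" "x \<noteq> 0" "y \<noteq> 0"
  shows "pt b g x = pt b g y \<longleftrightarrow> x * s y = y * s x"
proof
  assume "pt b g x = pt b g y"
  then show "x * s y = y * s x" using assms by (auto simp: pt_eq_iff s_mult)
next
  assume "x * s y = y * s x"
  then have "s (y / x) = y / x" "y = (y / x) * x" "y / x \<noteq> 0"
    using assms by (simp_all add: s_divide frac_eq_eq mult.commute)
  then show "pt b g x = pt b g y"
    using assms pt_eq_iff by blast
qed

lemma incident_pt_cls:
  "incident (pt b g x) (cls (d, e, f)) \<longleftrightarrow> d * x + e * b * s x + f * g * s (s x) = 0"
  by (simp add: pt_def mult.assoc)

text \<open>The factors \<open>b\<close> and \<open>g\<close> of the point cancel against the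
  inverse factors of the line.\<close>

lemma incident_pt_pt:
  assumes "b \<noteq> 0" "g \<noteq> 0"
  shows "incident (pt b g x) (pt (1 / b) (1 / g) u) \<longleftrightarrow> trace (u * x) = 0"
  using assms by (simp add: pt_def trace_def s_mult)

text \<open>The common factor is the first entry of the cross product of the conjugate vectors of
  \<open>x\<close> and \<open>y\<close>, and its conjugates are the other entries. Each trace is
  thus a determinant with a repeated row.\<close>

lemma cross_trace:
  "trace ((s x * s (s y) - s (s x) * s y) * x) = 0"
  "trace ((s x * s (s y) - s (s x) * s y) * y) = 0"
  by (simp_all add: trace_def s_hom algebra_simps)

lemma cross_ne_0_iff: "s x * s (s y) - s (s x) * s y \<noteq> 0 \<longleftrightarrow> x * s y \<noteq> y * s x"
proof -
  have "s x * s (s y) - s (s x) * s y = s (x * s y) - s (y * s x)"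
    by (simp add: s_mult mult.commute)
  then show ?thesis by simp
qed

text \<open>The line through two points of the subplane is the cross product of their coordinate vectors,
  whose entries are conjugate up to the factors b and g.\<close>
lemma line_eq_pt:
  assumes "b \<noteq> 0" "g \<noteq> 0" "x * s y \<noteq> y * s x" "l \<in> PG"
    and "incident (pt b g x) l" "incident (pt b g y) l"
  shows "l = pt (1 / b) (1 / g) (s x * s (s y) - s (s x) * s y)"
proof -
  define u where "u = s x * s (s y) - s (s x) * s y"
  have u: "u \<noteq> 0" using assms(3) unfolding u_def cross_ne_0_iff .
  obtain d e f where l: "l = cls (d, e, f)" "(d, e, f) \<noteq> (0, 0, 0)"
    using assms(4) by (rule PG_cases)
  have "cross (x, s x, s (s x)) (y, s y, s (s y)) = (u, s u, s (s u))"
    by (simp add: u_def s_hom algebra_simps)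
  \<comment> \<open>Moving \<open>b\<close> and \<open>g\<close> from the points into the line
    coefficients leaves plain vectors of conjugates.\<close>
  then have "cls (d, e * b, f * g) = cls (u, s u, s (s u))"
    using cls_eq_cross[of "(d, e * b, f * g)" "(x, s x, s (s x))" "(y, s y, s (s y))"]
      assms(1,2,5,6) l u by (auto simp: incident_pt_cls)
  then obtain c where c: "c \<noteq> 0" "(u, s u, s (s u)) = smul3 c (d, e * b, f * g)"
    unfolding cls_eq_iff by blast
  then have su: "c * d = u" "s u = c * (e * b)" "s (s u) = c * (f * g)"
    by auto
  have "1 / b * s u = c * e" "1 / g * s (s u) = c * f"
    using assms(1,2) by (simp add: su(2), simp add: su(3))
  then have "(u, 1 / b * s u, 1 / g * s (s u)) = smul3 c (d, e, f)"
    by (simp only: smul3.simps su(1))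
  with c(1) have "cls (d, e, f) = cls (u, 1 / b * s u, 1 / g * s (s u))"
    unfolding cls_eq_iff by blast
  then show ?thesis by (simp only: l(1) pt_def u_def)
qed

text \<open>The trace equation has \<open>q ^ 2 - 1\<close> nonzero solutions, and each point arises
  from \<open>q - 1\<close> of them, the fixed multiples of one solution.\<close>

lemma card_points_on_line:
  assumes "b \<noteq> 0" "g \<noteq> 0" "u \<noteq> 0"
  shows "card {P \<in> pl b g. incident P (pt (1 / b) (1 / g) u)} = q + 1"
proof -
  define A where "A = {x. x \<noteq> 0 \<and> trace (u * x) = 0}"
  have "bij_betw (\<lambda>x. u * x) {x. trace (u * x) = 0} {x. trace x = 0}"
    by (rule bij_betw_byWitness[where f' = "\<lambda>x. x / u"]) (use assms in auto)
  then have "card {x. trace (u * x) = 0} = q\<^sup>2"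
    by (simp add: bij_betw_same_card card_trace_kernel)
  moreover have "{x. trace (u * x) = 0} = insert 0 A" "0 \<notin> A"
    by (auto simp: A_def trace_def)
  ultimately have cA: "card A + 1 = q\<^sup>2"
    by (metis card_insert_disjoint finite Suc_eq_plus1)
  have "card {x \<in> A. pt b g x = pt b g y} = q - 1" if y: "y \<in> A" for y
  proof -
    have "{x \<in> A. pt b g x = pt b g y} = {x \<in> A. pt b g y = pt b g x}" by auto
    also have "\<dots> = {x \<in> A. \<exists>t. t \<noteq> 0 \<and> s t = t \<and> x = t * y}"
      using y assms by (intro Collect_cong conj_cong refl pt_eq_iff) (auto simp: A_def)
    also have "\<dots> = (\<lambda>t. t * y) ` ({t. s t = t} - {0})"
    proof -
      have "trace (u * (t * y)) = 0" if "s t = t" for t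
        using that y trace_mult_fixed[of t "u * y"] by (simp add: A_def mult.left_commute)
      then show ?thesis
        using y by (auto simp: A_def)
    qed
    also have "card \<dots> = card ({t. s t = t} - {0})"
      using y by (intro card_image inj_onI) (auto simp: A_def)
    also have "\<dots> = q - 1" by (simp add: card_fixed)
    finally show ?thesis .
  qed
  then have "card A = card (pt b g ` A) * (q - 1)"
    by (intro card_eq_card_image_times_fibre) auto
  moreover have "q\<^sup>2 = (q + 1) * (q - 1) + 1"
    using q_ge_2 by (cases q) (auto simp: power2_eq_square)
  ultimately have "card (pt b g ` A) * (q - 1) = (q + 1) * (q - 1)"
    using cA by linarith
  then have "card (pt b g ` A) = q + 1"
    using q_ge_2 by (subst (asm) mult_right_cancel) auto
  moreover have "{P \<in> pl b g. incident P (pt (1 / b) (1 / g) u)} = pt b g ` A"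
    using assms by (auto simp: pl_def A_def incident_pt_pt)
  ultimately show ?thesis by simp
qed

lemma line_of_card_ge_2:
  assumes "b \<noteq> 0" "g \<noteq> 0" "l \<in> PG" "2 \<le> card {P \<in> pl b g. incident P l}"
  shows "l \<in> pl (1 / b) (1 / g)"
proof -
  obtain P Q where PQ: "P \<in> pl b g" "incident P l" "Q \<in> pl b g" "incident Q l" "P \<noteq> Q"
    using assms(4) by (rule two_le_cardE) auto
  obtain x where x: "x \<noteq> 0" "P = pt b g x" using PQ(1) by (rule pl_cases)
  obtain y where y: "y \<noteq> 0" "Q = pt b g y" using PQ(3) by (rule pl_cases)
  have xy: "x * s y \<noteq> y * s x"
    using PQ(5) pt_eq_iff_cross[OF assms(1,2) x(1) y(1)] by (simp add: x y)
  have "l = pt (1 / b) (1 / g) (s x * s (s y) - s (s x) * s y)"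
    using line_eq_pt[OF assms(1,2) xy assms(3)] PQ x y by simp
  with xy show ?thesis
    unfolding pl_def cross_ne_0_iff[symmetric] by (intro image_eqI) auto
qed

text \<open>As \<open>q + 1\<close> is at least 2, a line of the plane joins two of its points and
  so has inverted parameters; conversely such a line carries \<open>q + 1\<close> points.\<close>

lemma lines_of_pl:
  assumes "b \<noteq> 0" "g \<noteq> 0"
  shows "lines_of q (pl b g) = pl (1 / b) (1 / g)"
proof
  show "lines_of q (pl b g) \<subseteq> pl (1 / b) (1 / g)"
    using assms q_ge_2 by (auto simp: lines_of_def intro: line_of_card_ge_2)
  show "pl (1 / b) (1 / g) \<subseteq> lines_of q (pl b g)"
    using assms card_points_on_line by (auto simp: lines_of_def pl_def pt_in_PG)
qed

lemma Fq_plane_pl: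
  assumes bg: "b \<noteq> 0" "g \<noteq> 0"
  shows "Fq_plane q (pl b g)"
proof -
  have bg': "1 / b \<noteq> 0" "1 / g \<noteq> 0" using assms by auto
  have meet: "\<exists>P\<in>pl b g. incident P l \<and> incident P m"
    if lm: "l \<in> pl (1 / b) (1 / g)" "m \<in> pl (1 / b) (1 / g)" "l \<noteq> m" for l m
  proof -
    obtain u v where u: "l = pt (1 / b) (1 / g) u" "m = pt (1 / b) (1 / g) v" "u \<noteq> 0" "v \<noteq> 0"
      using lm(1,2) by (elim pl_cases)
    \<comment> \<open>The formula for the line through two points, read dually, gives the parameter
      of the common point.\<close>
    define x where "x = s u * s (s v) - s (s u) * s v"
    have "u * s v \<noteq> v * s u"
      using lm(3) pt_eq_iff_cross[OF bg' u(3,4)] unfolding u(1,2) by blast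
    then have "x \<noteq> 0"
      unfolding x_def cross_ne_0_iff .
    moreover have "trace (u * x) = 0" "trace (v * x) = 0"
      using cross_trace[of u v] unfolding x_def mult.commute[of u] mult.commute[of v] by blast+
    ultimately show ?thesis
      using pt_in_pl incident_pt_pt[OF bg] unfolding u(1,2) by blast
  qed
  have quad: "\<exists>P1\<in>pl b g. \<exists>P2\<in>pl b g. \<exists>P3\<in>pl b g. \<exists>P4\<in>pl b g. distinct [P1, P2, P3, P4]
          \<and> \<not> collinear3 P1 P2 P3 \<and> \<not> collinear3 P1 P2 P4
          \<and> \<not> collinear3 P1 P3 P4 \<and> \<not> collinear3 P2 P3 P4"
  proof -
    \<comment> \<open>The quadrangle has parameters 1, \<open>w\<close>, \<open>z\<close> and their
      sum \<open>r\<close>: as \<open>w\<close> is not fixed, 1 and \<open>w\<close> give distinct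
      points, \<open>u\<close> is the line through them, and \<open>z\<close> is chosen off
      it.\<close>
    obtain w where w: "s w \<noteq> w" using ex_not_fixed by auto
    define u where "u = s 1 * s (s w) - s (s 1) * s w"
    have u0: "u \<noteq> 0" using w unfolding u_def cross_ne_0_iff by simp
    have u1: "trace u = 0" "trace (u * w) = 0" using cross_trace[of 1 w] by (simp_all add: u_def)
    obtain y where "trace y \<noteq> 0" using ex_trace_ne_0 by auto
    then have "trace (u * (y / u)) \<noteq> 0" using u0 by simp
    then obtain z where z: "trace (u * z) \<noteq> 0" by blast
    define r where "r = 1 + w + z"
    have ur: "trace (u * r) = trace (u * z)"
      using u1 by (simp add: r_def distrib_left trace_add)
    have nz: "1 \<noteq> (0::'a)" "w \<noteq> 0" "z \<noteq> 0" "r \<noteq> 0"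
      using w z ur by (auto simp: trace_def)
    have gen: False if "l \<in> PG" "incident (pt b g 1) l" "incident (pt b g w) l" "incident (pt b g z) l" for l
    proof -
      have "l = pt (1 / b) (1 / g) u"
        using line_eq_pt[OF bg, of 1 w l] that w by (simp add: u_def)
      then show False using that(4) z bg by (simp add: incident_pt_pt)
    qed
    have lin: "\<not> collinear3 (pt b g 1) (pt b g w) (pt b g z)"
      "\<not> collinear3 (pt b g 1) (pt b g w) (pt b g r)"
      "\<not> collinear3 (pt b g 1) (pt b g z) (pt b g r)"
      "\<not> collinear3 (pt b g w) (pt b g z) (pt b g r)"
    proof -
      \<comment> \<open>Incidence with \<open>l\<close> is the vanishing of an additive form, and
        \<open>r\<close> is the sum of the other three parameters. So a line through any three of
        the points contains the first three.\<close>
      have "incident (pt b g 1) l \<and> incident (pt b g w) l \<and> incident (pt b g z) l"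
        if "l \<in> PG" and "incident (pt b g 1) l \<and> incident (pt b g w) l \<and> incident (pt b g z) l
          \<or> incident (pt b g 1) l \<and> incident (pt b g w) l \<and> incident (pt b g r) l
          \<or> incident (pt b g 1) l \<and> incident (pt b g z) l \<and> incident (pt b g r) l
          \<or> incident (pt b g w) l \<and> incident (pt b g z) l \<and> incident (pt b g r) l" for l
      proof -
        obtain d e f where l: "l = cls (d, e, f)" using \<open>l \<in> PG\<close> by (rule PG_cases)
        define L where "L x = d * x + e * b * s x + f * g * s (s x)" for x
        have inc: "incident (pt b g x) l \<longleftrightarrow> L x = 0" for x
          by (simp add: l L_def incident_pt_cls)
        have "L r = L 1 + L w + L z"
          by (simp add: L_def r_def s_add algebra_simps)
        then show ?thesis using that(2) unfolding inc by auto
      qed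
      then show "\<not> collinear3 (pt b g 1) (pt b g w) (pt b g z)"
        "\<not> collinear3 (pt b g 1) (pt b g w) (pt b g r)"
        "\<not> collinear3 (pt b g 1) (pt b g z) (pt b g r)"
        "\<not> collinear3 (pt b g w) (pt b g z) (pt b g r)"
        unfolding collinear3_def using gen by blast+
    qed
    have ne: "pt b g x \<noteq> pt b g y" if xy: "trace (u * x) = 0" "trace (u * y) \<noteq> 0" "x \<noteq> 0" "y \<noteq> 0" for x y
    proof
      assume "pt b g x = pt b g y"
      then obtain t where t: "s t = t" "y = t * x"
        using pt_eq_iff[OF bg xy(3,4)] by blast
      then have "trace (u * y) = t * trace (u * x)"
        using trace_mult_fixed[of t "u * x"] by (simp add: mult.left_commute)
      with xy show False by simp
    qed
    have "pt b g z \<noteq> pt b g r"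
    proof
      assume "pt b g z = pt b g r"
      then obtain t where t: "s t = t" "r = t * z" using pt_eq_iff[OF bg nz(3,4)] by blast
      \<comment> \<open>\<open>z\<close> and \<open>r\<close> have the same nonzero trace against
        \<open>u\<close>, which forces \<open>t = 1\<close> and then \<open>1 + w = 0\<close>; but
        -1 is fixed by \<open>s\<close>.\<close>
      have "trace (u * r) = t * trace (u * z)"
        using trace_mult_fixed[of t "u * z"] t by (simp add: mult.left_commute)
      with ur z have "t = 1" by simp
      with t have "w = - 1" by (simp add: r_def add_eq_0_iff add.commute)
      with w show False using s_diff[of 0 1] by simp
    qed
    moreover have "pt b g 1 \<noteq> pt b g w" using w pt_eq_iff_cross[OF bg nz(1,2)] by simp
    ultimately have "distinct [pt b g 1, pt b g w, pt b g z, pt b g r]"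
      using ne[of 1 z] ne[of 1 r] ne[of w z] ne[of w r] u1 z ur nz by simp
    then show ?thesis
      using lin pt_in_pl nz by blast
  qed
  show ?thesis unfolding Fq_plane_def
  proof (intro conjI quad)
    show "pl b g \<subseteq> PG" using pt_in_PG by (auto elim!: pl_cases)
    show "\<forall>l\<in>PG. 2 \<le> card {P \<in> pl b g. incident P l} \<longrightarrow> card {P \<in> pl b g. incident P l} = q + 1"
      using line_of_card_ge_2[OF bg] by (auto simp: lines_of_pl[OF bg, symmetric] lines_of_def)
    show "\<forall>l\<in>PG. \<forall>m\<in>PG. l \<noteq> m \<and> 2 \<le> card {P \<in> pl b g. incident P l} \<and>
        2 \<le> card {P \<in> pl b g. incident P m} \<longrightarrow> (\<exists>P\<in>pl b g. incident P l \<and> incident P m)"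
      using line_of_card_ge_2[OF bg] meet by blast
  qed
qed

section \<open>Orbits of the torus that are planes\<close>

lemma psi_cls: "psi q t (cls v) = cls (psiv q t v)"
proof -
  have *: "psiv q t (smul3 c v) = smul3 c (psiv q t v)" for c
    by (cases v) (simp add: algebra_simps)
  show ?thesis
    by (simp only: psi_def cls_def setcompr_eq_image image_image *)
qed

lemma psi_orbit_eq:
  "{psi q t (cls (a, b, c)) | t. t \<noteq> 0} = (\<lambda>t. cls (t * a, s t * b, s (s t) * c)) ` (- {0})"
proof -
  have "{t :: 'a. t \<noteq> 0} = - {0}" by auto
  then show ?thesis
    by (simp only: setcompr_eq_image psi_cls psiv.simps power_q2) (simp only: s_eq)
qed

lemma pl_in_orbS: "pl b g \<in> orbS q"
proof -
  have "pl b g = {psi q t (cls (1, b, g)) | t. t \<noteq> 0}"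
    unfolding psi_orbit_eq pl_def pt_def by (simp add: mult.commute)
  moreover have "cls (1, b, g) \<in> PG" by simp
  ultimately show ?thesis unfolding orbS_def by blast
qed

text \<open>If a coordinate of the base point vanished, the whole orbit would lie on a coordinate
  line, against the quadrangle.\<close>

lemma Fq_plane_orbit_eq_pl:
  assumes "B \<in> orbS q" "Fq_plane q B"
  obtains b g where "b \<noteq> 0" "g \<noteq> 0" "B = pl b g"
proof -
  obtain P where "P \<in> PG" "B = {psi q t P | t. t \<noteq> 0}"
    using assms(1) unfolding orbS_def by blast
  moreover obtain a b c where "P = cls (a, b, c)"
    using \<open>P \<in> PG\<close> by (rule PG_cases)
  ultimately have B: "B = (\<lambda>t. cls (t * a, s t * b, s (s t) * c)) ` (- {0})"
    by (simp only: psi_orbit_eq)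
  obtain P1 P2 P3 where P: "P1 \<in> B" "P2 \<in> B" "P3 \<in> B" "\<not> collinear3 P1 P2 P3"
  proof -
    have "\<exists>P1\<in>B. \<exists>P2\<in>B. \<exists>P3\<in>B. \<not> collinear3 P1 P2 P3"
      using assms(2) unfolding Fq_plane_def by (elim conjE bexE) (intro bexI)
    then show thesis using that by blast
  qed
  have *: "\<not> (\<forall>P\<in>B. incident P (cls v))" if "v \<noteq> (0, 0, 0)" for v
  proof -
    have "cls v \<in> PG" using that by simp
    then show ?thesis using P unfolding collinear3_def by blast
  qed
  have "a \<noteq> 0" using *[of "(1, 0, 0)"] by (auto simp: B)
  have "b \<noteq> 0" using *[of "(0, 1, 0)"] by (auto simp: B)
  have "c \<noteq> 0" using *[of "(0, 0, 1)"] by (auto simp: B)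
  \<comment> \<open>Taking \<open>t * a\<close> as the new parameter normalises the first coordinate
    of the base point to 1.\<close>
  have "pt (b / s a) (c / s (s a)) (t * a) = cls (t * a, s t * b, s (s t) * c)" for t
    using \<open>a \<noteq> 0\<close> by (simp add: pt_def s_mult mult.commute)
  then have "B = (\<lambda>t. pt (b / s a) (c / s (s a)) (t * a)) ` (- {0})"
    by (simp only: B)
  also have "\<dots> = pt (b / s a) (c / s (s a)) ` (\<lambda>t. t * a) ` (- {0})" by (simp add: image_image)
  also have "(\<lambda>t. t * a) ` (- {0}) = - {0}"
    using \<open>a \<noteq> 0\<close> by (intro image_Compl_0[where g = "\<lambda>t. t / a"]) auto
  finally show thesis
    using that[of "b / s a" "c / s (s a)"] \<open>a \<noteq> 0\<close> \<open>b \<noteq> 0\<close> \<open>c \<noteq> 0\<close> by (simp add: pl_def)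
qed

section \<open>The map mu\<close>

text \<open>A scalar \<open>c\<close> turns into \<open>s c\<close>, and \<open>s\<close> permutes
  the nonzero scalars, so the image is a full class.\<close>

lemma phi_cls: "phi q (cls (v :: 'a vec3)) = cls (phiv q v)"
proof -
  have *: "phiv q (smul3 c v) = smul3 (s c) (phiv q v)" for c
    by (cases v) (simp add: s_eq power_mult_distrib)
  have "s ` (- {0}) = - {0}"
    by (rule image_Compl_0[where g = "\<lambda>x. s (s x)"]) auto
  moreover have "{c :: 'a. c \<noteq> 0} = - {0}" by auto
  moreover have "phi q (cls v) = (\<lambda>c. smul3 c (phiv q v)) ` s ` {c. c \<noteq> 0}"
    by (simp only: phi_def cls_def setcompr_eq_image image_image *)
  ultimately show ?thesis
    by (simp only: cls_def setcompr_eq_image)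
qed

definition mu_vec :: "'a vec3 \<Rightarrow> 'a vec3" where
  "mu_vec v = cross (phiv q v) (phiv q (phiv q v))"

text \<open>A nonzero cross product means that the two image points differ, so the description in
  \<open>mu_pt\<close> has a unique solution.\<close>

lemma mu_pt_cls:
  assumes "mu_vec v \<noteq> (0, 0, 0)"
  shows "mu_pt q (cls v) = cls (mu_vec v)"
  unfolding mu_pt_def
proof (rule the_equality)
  show "cls (mu_vec v) \<in> PG \<and> incident (phi q (cls v)) (cls (mu_vec v)) \<and>
    incident (phi q (phi q (cls v))) (cls (mu_vec v))"
    using assms by (simp add: phi_cls mu_vec_def dot3_cross)
  fix l assume l: "l \<in> PG \<and> incident (phi q (cls v)) l \<and> incident (phi q (phi q (cls v))) l"
  then obtain w where w: "l = cls w" "w \<noteq> (0, 0, 0)" by (metis PG_cases)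
  then have "dot3 w (phiv q v) = 0" "dot3 w (phiv q (phiv q v)) = 0"
    using l by (auto simp: phi_cls)
  from this w(2) assms have "cls w = cls (mu_vec v)"
    unfolding mu_vec_def by (rule cls_eq_cross)
  then show "l = cls (mu_vec v)" using w(1) by simp
qed

text \<open>The scalar is the determinant of \<open>v\<close> and its two images. A line through all
  three points would have to be \<open>cls (mu_vec v)\<close>.\<close>

lemma typeIII_ptI:
  assumes "dot3 (mu_vec v) v \<noteq> 0"
  shows "typeIII_pt q (cls v)"
proof -
  have mu: "mu_vec v \<noteq> (0, 0, 0)"
    using assms by (cases v) auto
  have v: "v \<noteq> (0, 0, 0)"
    using assms by (cases "mu_vec v") auto
  have "\<not> collinear3 (cls v) (phi q (cls v)) (phi q (phi q (cls v)))"
  proof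
    assume "collinear3 (cls v) (phi q (cls v)) (phi q (phi q (cls v)))"
    then obtain w where w: "w \<noteq> (0, 0, 0)" "dot3 w v = 0"
        "dot3 w (phiv q v) = 0" "dot3 w (phiv q (phiv q v)) = 0"
      unfolding collinear3_def phi_cls by (metis PG_cases incident_cls)
    have "cls w = cls (mu_vec v)"
      using w(3,4,1) mu unfolding mu_vec_def by (rule cls_eq_cross)
    then have "incident (cls v) (cls w) \<longleftrightarrow> incident (cls v) (cls (mu_vec v))" by simp
    then show False using w assms by simp
  qed
  with v show ?thesis
    by (simp add: typeIII_pt_def)
qed

text \<open>For nonzero \<open>x\<close> the dependence on \<open>x\<close> is the norm of
  \<open>x\<close> times its inverse conjugates: \<open>mu\<close> inverts the torus
  parameter.\<close>

lemma mu_vec_eq: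
  "mu_vec (x, b * s x, g * s (s x)) =
    (s x * s (s x) * (1 - s b * s (s g)),
     x * s (s x) * (s b * s (s b) - s g),
     x * s x * (s g * s (s g) - s (s b)))"
  by (simp add: mu_vec_def algebra_simps flip: s_eq) (simp add: s_mult algebra_simps)

text \<open>If the cross product vanishes, the two image points coincide and the orbit is
  collinear.\<close>

lemma typeIII_imp_mu_vec_ne_0:
  assumes "typeIII_pt q (cls (1, b, g))"
  shows "mu_vec (1, b, g) \<noteq> (0, 0, 0)"
proof
  assume "mu_vec (1, b, g) = (0, 0, 0)"
  then have "s b * s (s g) = 1" "s b * s (s b) = s g"
    using mu_vec_eq[of 1 b g] by auto
  then have "s (s (s b * s (s g))) = 1" "s (s b * s (s b)) = s (s g)" by simp_all
  then have *: "b * s g = 1" "b * s (s b) = s (s g)"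
    by (simp_all add: s_mult mult.commute)
  have "phiv q (1, b, g) = (s g, 1, s b)" "phiv q (phiv q (1, b, g)) = (s (s b), s (s g), 1)"
    by (simp_all flip: s_eq)
  \<comment> \<open>The witness [b, -1, 0] is the line joining (1, b, g) to (0, 0, 1).\<close>
  then have "collinear3 (cls (1, b, g)) (phi q (cls (1, b, g))) (phi q (phi q (cls (1, b, g))))"
    unfolding collinear3_def phi_cls using * by (intro bexI[of _ "cls (b, - 1, 0)"]) auto
  then show False using assms by (simp add: typeIII_pt_def)
qed

section \<open>Equations forced on the parameters of a fixed plane\<close>

text \<open>When \<open>s\<close> fixes \<open>B\<close> and \<open>C\<close>, \<open>phiv q\<close>
  maps the vector of the three nonzero entries to \<open>(C - s (s e), 1 - s e, B - e)\<close>. The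
  equations are the vanishing minors of these two vectors.\<close>

definition mu_eqs :: "'a \<Rightarrow> 'a \<Rightarrow> 'a \<Rightarrow> bool" where
  "mu_eqs e B C \<longleftrightarrow> 1 - e \<noteq> 0 \<and> B - s (s e) \<noteq> 0 \<and> C - s e \<noteq> 0
    \<and> (C - s e) * (1 - s e) = (B - e) * (B - s (s e))
    \<and> (C - s (s e)) * (B - s (s e)) = (1 - e) * (1 - s e)
    \<and> (C - s (s e)) * (C - s e) = (1 - e) * (B - e)"

text \<open>The hypothesis says that the vector with entries 1 - e, B - s (s e) and C - s e is proportional
  to one of the form (v, s v, s (s v)), where B and C are the norms of b and g.\<close>
lemma mu_eqs_if_mu_pt_in_pl:
  assumes bg: "b \<noteq> 0" "g \<noteq> 0"
    and "typeIII_pt q (pt b g 1)" "mu_pt q (pt b g 1) \<in> pl (1 / b) (1 / g)"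
  shows "mu_eqs (s b * s (s g)) (b * s b * s (s b)) (g * s g * s (s g))"
proof -
  define e B C where "e = s b * s (s g)" and "B = b * s b * s (s b)" and "C = g * s g * s (s g)"
  have pt: "pt b g 1 = cls (1, b, g)" by (simp add: pt_def)
  have "cls (mu_vec (1, b, g)) \<in> pl (1 / b) (1 / g)"
    using assms typeIII_imp_mu_vec_ne_0[of b g] by (simp add: pt mu_pt_cls)
  then obtain v where v: "v \<noteq> 0" "cls (v, 1 / b * s v, 1 / g * s (s v)) = cls (mu_vec (1, b, g))"
    by (auto simp: pl_def pt_def)
  then obtain c where c: "c \<noteq> 0" "mu_vec (1, b, g) = smul3 c (v, 1 / b * s v, 1 / g * s (s v))"
    unfolding cls_eq_iff by blast
  then have "1 - s b * s (s g) = c * v" "s b * s (s b) - s g = c * (s v / b)"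
    "s g * s (s g) - s (s b) = c * (s (s v) / g)"
    using mu_vec_eq[of 1 b g] by auto
  \<comment> \<open>Multiplying the last two entries by \<open>b\<close> and \<open>g\<close>
    produces the norms, since \<open>s (s e) = b * s g\<close> and
    \<open>s e = g * s (s b)\<close>.\<close>
  then have A1: "1 - e = c * v" and B1: "B - s (s e) = c * s v" and C1: "C - s e = c * s (s v)"
    using bg by (auto simp: e_def B_def C_def s_mult field_simps)
  have sB: "s B = B" "s C = C" by (simp_all add: B_def C_def s_mult mult.commute mult.left_commute)
  have A2: "1 - s e = s c * s v"
    using arg_cong[OF A1, of s] by (simp add: s_hom)
  have B2: "B - e = s c * s (s v)"
    using arg_cong[OF B1, of s] by (simp add: s_hom sB)
  have C2: "C - s (s e) = s c * v"
    using arg_cong[OF C1, of s] by (simp add: s_hom sB)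
  show ?thesis
    unfolding e_def[symmetric] B_def[symmetric] C_def[symmetric] mu_eqs_def A1 B1 C1 A2 B2 C2
    using v(1) c(1) by (simp add: mult_ac)
qed

text \<open>The two systems have the same numerators up to sign, so only the denominators remain.\<close>
lemma mu_eqs_imp_cube_eq_1:
  assumes "mu_eqs e B C" "mu_eqs (1 / e) (1 / B) (1 / C)"
    and nz: "e \<noteq> 0" "B \<noteq> 0" "C \<noteq> 0" and N: "e * s e * s (s e) = B * C" and sB: "s B = B"
  shows "e ^ 3 = 1" "B ^ 3 = 1" "C ^ 3 = 1"
proof -
  define f g where "f = s e" and "g = s (s e)"
  have nz': "f \<noteq> 0" "g \<noteq> 0" using nz by (auto simp: f_def g_def)
  have ne: "1 - e \<noteq> 0" "B - g \<noteq> 0" "C - f \<noteq> 0"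
    using assms(1) by (auto simp: mu_eqs_def f_def g_def)
  have ne': "1 - f \<noteq> 0" "B - e \<noteq> 0"
    using ne s_eq_iff[of e 1] s_eq_iff[of "s (s e)" B] by (auto simp: f_def g_def sB)
  have 1: "(C - f) * (1 - f) = (B - e) * (B - g)"
    and 2: "(C - g) * (B - g) = (1 - e) * (1 - f)"
    and 3: "(C - g) * (C - f) = (1 - e) * (B - e)"
    using assms(1) by (auto simp: mu_eqs_def f_def g_def)
  have "(1 / C - 1 / f) * (1 - 1 / f) = (1 / B - 1 / e) * (1 / B - 1 / g)"
    and "(1 / C - 1 / g) * (1 / B - 1 / g) = (1 - 1 / e) * (1 - 1 / f)"
    and "(1 / C - 1 / g) * (1 / C - 1 / f) = (1 - 1 / e) * (1 / B - 1 / e)"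
    using assms(2) by (auto simp: mu_eqs_def f_def g_def s_divide)
  moreover have "1 / x - 1 / y = (x - y) * (- 1 / (x * y))" "1 - 1 / y = (1 - y) * (- 1 / y)"
    if "x \<noteq> 0" "y \<noteq> 0" for x y :: 'a
    using that by (auto simp: field_simps)
  ultimately have
    d1: "((C - f) * (1 - f)) * (1 / (C * f * f)) = ((B - e) * (B - g)) * (1 / (B * e * B * g))"
    and d2: "((C - g) * (B - g)) * (1 / (C * g * B * g)) = ((1 - e) * (1 - f)) * (1 / (e * f))"
    and d3: "((C - g) * (C - f)) * (1 / (C * g * C * f)) = ((1 - e) * (B - e)) * (1 / (e * B * e))"
    using nz nz' by (simp_all add: mult_ac)
  \<comment> \<open>With \<open>1 / 0 = 0\<close> inversion is injective on the whole field, so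
    equal reciprocals suffice.\<close>
  have cancel: "u = v" if "x * (1 / u) = y * (1 / v)" "x = y" "y \<noteq> 0" for x y u v :: 'a
    using that by simp
  have "C * g * B * g = e * f"
    by (rule cancel[OF d2 2]) (use ne ne' in simp)
  \<comment> \<open>Multiplying by \<open>g\<close> completes the norm
    \<open>e * f * g = B * C\<close>. The two cases below use the factors \<open>f\<close> and
    \<open>e\<close> likewise.\<close>
  then have "B * C * g ^ 3 = B * C"
    using N by (simp add: f_def g_def power3_eq_cube) algebra
  then have g3: "g ^ 3 = 1" using nz by simp
  then have "s (s (e ^ 3)) = s (s 1)" by (simp add: g_def s_power)
  then show e3: "e ^ 3 = 1" by (simp only: s_eq_iff)
  then have f3: "f ^ 3 = 1" by (simp add: f_def flip: s_power)
  have "C * f * f = B * e * B * g"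
    by (rule cancel[OF d1 1]) (use ne ne' in simp)
  then have "C * f ^ 3 = B ^ 3 * C"
    using N[folded f_def g_def] by (simp add: power3_eq_cube) algebra
  then show "B ^ 3 = 1" using f3 nz by simp
  have "C * g * C * f = e * B * e"
    by (rule cancel[OF d3 3]) (use ne ne' in simp)
  then have "B * C ^ 3 = B * e ^ 3"
    using N[folded f_def g_def] by (simp add: power3_eq_cube) algebra
  then show "C ^ 3 = 1" using e3 nz by simp
qed

text \<open>The point and the line with parameter 1 already supply both systems, because the lines
  form the plane with inverted parameters. The last equation compares norms.\<close>

lemma mu_fixes_pl_imp:
  assumes bg: "b \<noteq> 0" "g \<noteq> 0" and "mu_fixes q (pl b g)"
  defines "e \<equiv> s b * s (s g)" and "B \<equiv> b * s b * s (s b)" and "C \<equiv> g * s g * s (s g)"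
  shows "mu_eqs e B C" "e ^ 3 = 1" "B ^ 3 = 1" "C ^ 3 = 1" "e * s e * s (s e) = B * C"
proof -
  have mf: "\<forall>P\<in>pl b g. typeIII_pt q P" "\<forall>l\<in>pl (1 / b) (1 / g). typeIII_pt q l"
    "mu_pt q ` pl b g = pl (1 / b) (1 / g)" "mu_pt q ` pl (1 / b) (1 / g) = pl b g"
    using assms(3) bg unfolding mu_fixes_def typeIII_line_eq_pt mu_line_eq_pt by (simp_all add: lines_of_pl)
  have pts: "pt b g 1 \<in> pl b g" "pt (1 / b) (1 / g) 1 \<in> pl (1 / b) (1 / g)"
    by (simp_all add: pl_def)
  show eqs: "mu_eqs e B C"
    unfolding e_def B_def C_def using mf pts by (intro mu_eqs_if_mu_pt_in_pl bg) auto
  have "mu_eqs (s (1 / b) * s (s (1 / g))) (1 / b * s (1 / b) * s (s (1 / b))) (1 / g * s (1 / g) * s (s (1 / g)))"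
    using mf pts bg by (intro mu_eqs_if_mu_pt_in_pl) auto
  then have eqs': "mu_eqs (1 / e) (1 / B) (1 / C)"
    by (simp add: e_def B_def C_def s_divide)
  show N: "e * s e * s (s e) = B * C"
    by (simp add: e_def B_def C_def s_mult mult_ac)
  have "s B = B" by (simp add: B_def s_mult mult_ac)
  moreover have "e \<noteq> 0" "B \<noteq> 0" "C \<noteq> 0" using bg by (auto simp: e_def B_def C_def)
  ultimately show "e ^ 3 = 1" "B ^ 3 = 1" "C ^ 3 = 1"
    using mu_eqs_imp_cube_eq_1[OF eqs eqs' _ _ _ N] by auto
qed

section \<open>Cube roots of unity\<close>

lemma cube_root_mod: "(x :: 'a) ^ 3 = 1 \<Longrightarrow> x ^ n = x ^ (n mod 3)"
  by (metis div_mult_mod_eq mult.commute mult.left_neutral power_add power_mult power_one)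

text \<open>Every element equals its power \<open>q ^ 3\<close>, and this exponent is 0 or 2 modulo
  3, so \<open>x\<close> equals 1 or its own square.\<close>

lemma cube_root_eq_1:
  assumes "(x :: 'a) ^ 3 = 1" "\<not> 3 dvd q - 1"
  shows "x = 1"
proof -
  have "x ^ (q ^ 3) = s (s (s x))"
    by (simp add: s_eq power3_eq_cube power_mult)
  then have "x = x ^ (q ^ 3)" by simp
  also have "\<dots> = x ^ (q ^ 3 mod 3)" by (rule cube_root_mod[OF assms(1)])
  finally have x: "x = x ^ (q ^ 3 mod 3)" .
  have "q mod 3 = 0 \<or> q mod 3 = 2" using assms(2) q_ge_2 by presburger
  then show ?thesis
  proof
    assume "q mod 3 = 0"
    then have "q ^ 3 mod 3 = 0" by (simp flip: power_mod)
    with x show ?thesis by simp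
  next
    assume "q mod 3 = 2"
    then have "q ^ 3 mod 3 = 2" by (simp flip: power_mod[of q])
    with x have "x * x = x * 1" by (simp add: power2_eq_square)
    moreover have "x \<noteq> 0" using assms(1) by auto
    ultimately show ?thesis using mult_left_cancel by blast
  qed
qed

lemma cube_root_fixed:
  assumes "(x :: 'a) ^ 3 = 1" "3 dvd q - 1"
  shows "s x = x"
proof -
  have "q mod 3 = 1" using assms(2) q_ge_2 by presburger
  then show ?thesis using cube_root_mod[OF assms(1), of q] by (simp add: s_eq)
qed

lemma primitive_cube_root:
  assumes "(x :: 'a) ^ 3 = 1" "x \<noteq> 1"
  shows "x\<^sup>2 + x + 1 = 0"
proof -
  have "(x - 1) * (x\<^sup>2 + x + 1) = 0" using assms(1) by (simp add: algebra_simps power2_eq_square power3_eq_cube)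
  then show ?thesis using assms(2) by simp
qed

text \<open>Both are roots of T^2 + T + 1, whose roots are \<open>x\<close> and
  \<open>- 1 - x\<close>, the latter being the square of \<open>x\<close>.\<close>

lemma primitive_cube_roots:
  assumes "(x :: 'a) ^ 3 = 1" "x \<noteq> 1" "y ^ 3 = 1" "y \<noteq> 1" "x \<noteq> y"
  shows "y = x\<^sup>2"
proof -
  have "(x - y) * (y - x\<^sup>2) = 0"
    using primitive_cube_root[OF assms(1,2)] primitive_cube_root[OF assms(3,4)] by algebra
  then show ?thesis using assms(5) by simp
qed

text \<open>For m = (q^3 - 1) / 3 the polynomial X^m - 1 has too few roots to vanish at every
  nonzero element; at a nonzero non-root \<open>a\<close>, the power \<open>a ^ m\<close> is the
  desired root of unity.\<close>

lemma ex_primitive_cube_root: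
  assumes "3 dvd q - 1"
  shows "\<exists>x :: 'a. x ^ 3 = 1 \<and> x \<noteq> 1"
proof -
  define m where "m = (q ^ 3 - 1) div 3"
  have "[q = 1] (mod 3)" using assms q_ge_2 by (simp add: cong_altdef_nat)
  then have "[q ^ 3 = 1] (mod 3)" using cong_pow by fastforce
  \<comment> \<open>This makes \<open>m\<close> positive, so the constant term of \<open>f\<close>
    below does not affect its coefficient at \<open>m\<close>.\<close>
  moreover have "8 \<le> q ^ 3" using power_mono[OF q_ge_2, of 3] by simp
  ultimately have m: "3 * m = q ^ 3 - 1" "0 < m" "m < q ^ 3 - 1"
    by (auto simp: m_def cong_altdef_nat)
  have "\<exists>a :: 'a. a \<noteq> 0 \<and> a ^ m \<noteq> 1"
  proof (rule ccontr)
    assume *: "\<not> ?thesis"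
    define f :: "'a poly" where "f = monom 1 m - 1"
    have "coeff f m = 1" using m by (simp add: f_def)
    then have "f \<noteq> 0" by auto
    moreover have "degree f \<le> m" by (auto simp: f_def intro!: degree_diff_le degree_monom_le)
    moreover have "- {0} \<subseteq> {x. poly f x = 0}" using * by (auto simp: f_def poly_monom)
    then have "card (- {0 :: 'a}) \<le> card {x. poly f x = 0}" by (rule card_mono[rotated]) simp
    moreover have "card (- {0 :: 'a}) = q ^ 3 - 1" by (simp add: Compl_eq_Diff_UNIV card_UNIV)
    ultimately show False using card_poly_roots_bound[of f] m by linarith
  qed
  then obtain a :: 'a where "a \<noteq> 0" "a ^ m \<noteq> 1" by blast
  moreover have "(a ^ m) ^ 3 = a ^ (q ^ 3 - 1)" using m by (simp add: mult.commute flip: power_mult)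
  then have "(a ^ m) ^ 3 = 1"
    using finite_field_power_card_minus_one[OF \<open>a \<noteq> 0\<close>] card_UNIV by simp
  ultimately show ?thesis by blast
qed

text \<open>The point with parameter 1 has equal first two coordinates, so its parameter in the
  other plane is fixed by \<open>s\<close> and the third coordinates must agree.\<close>

lemma pl_1_eq_iff:
  assumes "s x = x" "s y = y" "x \<noteq> 0" "y \<noteq> 0"
  shows "pl 1 x = pl 1 y \<longleftrightarrow> x = y"
proof
  assume "pl 1 x = pl 1 y"
  then have "pt 1 x 1 \<in> pl 1 y" using pt_in_pl[of 1 1 x] by simp
  then obtain z where z: "z \<noteq> 0" "cls (1, 1, x) = cls (z, s z, y * s (s z))"
    by (auto simp: pl_def pt_def)
  then obtain c where "c \<noteq> 0" "z = c" "s z = c" "y * s (s z) = c * x"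
    by (auto simp: cls_eq_iff)
  then show "x = y" by simp
qed simp

lemma mu_fixes_pl_imp_eq_pl_1:
  assumes bg: "b \<noteq> 0" "g \<noteq> 0" and mf: "mu_fixes q (pl b g)" and q3: "3 dvd q - 1"
  obtains e where "pl b g = pl 1 e" "e ^ 3 = 1" "e \<noteq> 1"
proof -
  define e B C where "e = s b * s (s g)" and "B = b * s b * s (s b)" and "C = g * s g * s (s g)"
  have eqs: "mu_eqs e B C" and e3: "e ^ 3 = 1" and B3: "B ^ 3 = 1" and "C ^ 3 = 1"
    and N: "e * s e * s (s e) = B * C"
    using mu_fixes_pl_imp[OF bg mf] by (simp_all add: e_def B_def C_def)
  have se: "s e = e" using cube_root_fixed[OF e3 q3] .
  have ne: "e \<noteq> 1" "B \<noteq> e" "C \<noteq> e" using eqs by (auto simp: mu_eqs_def se)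
  have BC: "B * C = 1" using N e3 by (simp add: se power3_eq_cube)
  \<comment> \<open>\<open>B\<close> is a cube root of unity other than \<open>e\<close>; if it were
    the square of \<open>e\<close>, then \<open>B * C = 1\<close> would give
    \<open>C = e\<close>.\<close>
  have B1: "B = 1"
  proof (rule ccontr)
    assume "B \<noteq> 1"
    then have "B = e\<^sup>2" using primitive_cube_roots[OF e3 ne(1) B3] ne by auto
    then have "B * C = B * e" using BC e3 by (simp add: power2_eq_square power3_eq_cube)
    moreover have "B \<noteq> 0" using B3 by auto
    ultimately show False using ne by simp
  qed
  then obtain x where x: "x \<noteq> 0" "b * s x = x"
    using norm_1_imp_quotient[of b] by (auto simp: B_def)
  have "s (s e) = b * s g" by (simp add: e_def s_mult mult.commute)
  then have bg1: "b * s g = e" by (simp add: se)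
  \<comment> \<open>Since \<open>b = x / s x\<close>, the left side equals \<open>b * s g\<close>.
    As \<open>s\<close> fixes \<open>e\<close>, the quotient itself is \<open>e\<close>.\<close>
  have "s (g * s (s x) / x) = e"
    using x bg1 by (simp add: s_hom) (metis mult.assoc mult.commute nonzero_mult_div_cancel_right s_eq_0_iff)
  then have ge: "g * s (s x) = e * x"
    using se x by (metis nonzero_eq_divide_eq s_eq_iff)
  have "pt b g (x * y) = pt 1 e y" if "y \<noteq> 0" for y
  proof -
    have "b * s (x * y) = x * s y" using x(2) by (metis mult.assoc s_mult)
    moreover have "g * s (s (x * y)) = x * (e * s (s y))" using ge by (simp add: s_mult mult_ac)
    ultimately have "(x * y, b * s (x * y), g * s (s (x * y))) = smul3 x (y, 1 * s y, e * s (s y))"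
      by simp
    then have "cls (y, 1 * s y, e * s (s y)) = cls (x * y, b * s (x * y), g * s (s (x * y)))"
      unfolding cls_eq_iff using x(1) by blast
    then show ?thesis by (simp only: pt_def)
  qed
  then have "pl 1 e = pt b g ` ((*) x ` (- {0}))"
    unfolding pl_def image_image by (intro image_cong) auto
  also have "(*) x ` (- {0}) = - {0}"
    using x by (intro image_Compl_0[where g = "\<lambda>y. y / x"]) auto
  finally have "pl b g = pl 1 e" by (simp add: pl_def)
  then show thesis using that e3 ne(1) by blast
qed

section \<open>The planes of primitive cube roots are fixed\<close>

text \<open>The determinant of the orbit is the norm of \<open>x\<close> times
  \<open>3 * (1 - l)\<close>, and each entry of \<open>mu_vec\<close> is divisible by
  \<open>1 - l\<close>.\<close>

lemma mu_pt_pl_1: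
  assumes l3: "l ^ 3 = 1" and l1: "l \<noteq> 1" and sl: "s l = l" and x: "x \<noteq> 0"
  shows "typeIII_pt q (pt 1 l x)" "mu_pt q (pt 1 l x) = pt 1 (1 / l) (1 / x)"
proof -
  have l: "l\<^sup>2 + l + 1 = 0" using primitive_cube_root[OF l3 l1] .
  have l0: "l \<noteq> 0" using l3 by auto
  have l2: "1 / l = l\<^sup>2" using l3 l0 by (simp add: field_simps power2_eq_square power3_eq_cube)
  \<comment> \<open>In characteristic 3 cubing is additive, so 1 would be the only cube root of
    unity.\<close>
  have three: "(3 :: 'a) \<noteq> 0"
  proof
    assume "(3 :: 'a) = 0"
    moreover have "(l - 1) ^ 3 = l ^ 3 - 1 - 3 * (l\<^sup>2 - l)"
      by (simp add: algebra_simps power2_eq_square power3_eq_cube)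
    ultimately have "(l - 1) ^ 3 = 0" using l3 by simp
    with l1 show False by simp
  qed
  have mu: "mu_vec (x, 1 * s x, l * s (s x)) =
      (s x * s (s x) * (1 - l), x * s (s x) * (1 - l), x * s x * (l * l - 1))"
    unfolding mu_vec_eq by (simp add: sl)
  have "dot3 (mu_vec (x, 1 * s x, l * s (s x))) (x, 1 * s x, l * s (s x))
      = x * s x * s (s x) * ((1 - l) + (1 - l) + l * (l * l - 1))"
    unfolding mu by (simp add: algebra_simps)
  also have "(1 - l) + (1 - l) + l * (l * l - 1) = 3 * (1 - l)"
    using l3 by (simp add: algebra_simps power3_eq_cube)
  finally have dot: "dot3 (mu_vec (x, 1 * s x, l * s (s x))) (x, 1 * s x, l * s (s x)) \<noteq> 0"
    using x three l1 by simp
  then show "typeIII_pt q (pt 1 l x)"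
    unfolding pt_def by (rule typeIII_ptI)
  have "mu_vec (x, 1 * s x, l * s (s x)) \<noteq> (0, 0, 0)"
    using dot by auto
  then have "mu_pt q (pt 1 l x) = cls (mu_vec (x, 1 * s x, l * s (s x)))"
    unfolding pt_def by (rule mu_pt_cls)
  also have "\<dots> = cls (1 / x, 1 * s (1 / x), 1 / l * s (s (1 / x)))"
  proof -
    have "l * l - 1 = (1 - l) * l\<^sup>2" using l3 l by algebra
    then have "mu_vec (x, 1 * s x, l * s (s x))
      = smul3 (x * s x * s (s x) * (1 - l)) (1 / x, 1 * s (1 / x), 1 / l * s (s (1 / x)))"
      unfolding mu l2 using x by (simp add: s_divide)
    moreover have "x * s x * s (s x) * (1 - l) \<noteq> 0" using x l1 by simp
    ultimately show ?thesis by (metis cls_eq_iff)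
  qed
  finally show "mu_pt q (pt 1 l x) = pt 1 (1 / l) (1 / x)" by (simp add: pt_def)
qed

text \<open>\<open>1 / l\<close> is again a primitive cube root of unity, which covers the lines;
  inverting parameters permutes the nonzero elements, so the images are full.\<close>

lemma mu_fixes_pl_1:
  assumes "l ^ 3 = 1" "l \<noteq> 1" "s l = l"
  shows "mu_fixes q (pl 1 l)"
proof -
  have l: "l \<noteq> 0" using assms by auto
  have inv: "(\<lambda>x. 1 / x) ` (- {0 :: 'a}) = - {0}"
    by (rule image_Compl_0[where g = "\<lambda>x. 1 / x"]) auto
  have *: "(\<forall>P\<in>pl 1 k. typeIII_pt q P) \<and> mu_pt q ` pl 1 k = pl 1 (1 / k)"
    if "k ^ 3 = 1" "k \<noteq> 1" "s k = k" for k
  proof -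
    have "mu_pt q ` pl 1 k = (\<lambda>x. pt 1 (1 / k) (1 / x)) ` (- {0})"
      unfolding pl_def image_image using mu_pt_pl_1[OF that] by (intro image_cong) auto
    also have "\<dots> = pt 1 (1 / k) ` (\<lambda>x. 1 / x) ` (- {0})"
      by (simp only: image_image)
    finally show ?thesis
      unfolding inv using mu_pt_pl_1[OF that] by (auto simp: pl_def)
  qed
  show ?thesis
    using *[of l] *[of "1 / l"] assms l
    by (simp add: mu_fixes_def typeIII_line_eq_pt mu_line_eq_pt lines_of_pl s_divide power_divide)
qed

lemma pi_lam_eq_pl: "pi_lam q l = pl 1 l"
  unfolding pi_lam_def pl_def pt_def power_q2 by (auto simp: s_eq)

section \<open>Fixed planes according to divisibility of q - 1 by 3\<close>

theorem no_fixed_plane: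
  assumes "\<not> 3 dvd q - 1"
  shows "\<not> (\<exists>B \<in> (orbS q :: 'a vec3 set set set). Fq_plane q B \<and> mu_fixes q B)"
proof
  assume "\<exists>B \<in> (orbS q :: 'a vec3 set set set). Fq_plane q B \<and> mu_fixes q B"
  then obtain b g :: 'a where bg: "b \<noteq> 0" "g \<noteq> 0" "mu_fixes q (pl b g)"
    by (metis Fq_plane_orbit_eq_pl)
  then have "s b * s (s g) = 1"
    using cube_root_eq_1[OF _ assms] mu_fixes_pl_imp(2) by blast
  then show False
    using mu_fixes_pl_imp(1)[OF bg] by (simp add: mu_eqs_def)
qed

theorem fixed_planes:
  assumes q3: "3 dvd q - 1"
  shows "{B \<in> (orbS q :: 'a vec3 set set set). Fq_plane q B \<and> mu_fixes q B}
      = pi_lam q ` {l. l ^ q = l \<and> l ^ 3 = 1 \<and> l \<noteq> 1}" (is "?L = ?R")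
    and "card {B \<in> (orbS q :: 'a vec3 set set set). Fq_plane q B \<and> mu_fixes q B} = 2"
proof -
  show eq: "?L = ?R"
  proof
    show "?L \<subseteq> ?R"
    proof
      fix B assume "B \<in> ?L"
      then have B: "B \<in> orbS q" "Fq_plane q B" "mu_fixes q B" by auto
      obtain b g where bg: "b \<noteq> 0" "g \<noteq> 0" "B = pl b g"
        using Fq_plane_orbit_eq_pl[OF B(1,2)] .
      obtain e where e: "pl b g = pl 1 e" "e ^ 3 = 1" "e \<noteq> 1"
        using mu_fixes_pl_imp_eq_pl_1[OF bg(1,2) B(3)[unfolded bg(3)] q3] .
      moreover have "e ^ q = e"
        using cube_root_fixed[OF e(2) q3] by (simp add: s_eq)
      ultimately show "B \<in> ?R"
        unfolding pi_lam_eq_pl bg(3) by blast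
    qed
    show "?R \<subseteq> ?L"
    proof
      fix B assume "B \<in> ?R"
      then obtain l where l: "B = pl 1 l" "s l = l" "l ^ 3 = 1" "l \<noteq> 1"
        unfolding pi_lam_eq_pl s_eq by blast
      then have "l \<noteq> 0" by auto
      then show "B \<in> ?L"
        using l pl_in_orbS Fq_plane_pl[of 1 l] mu_fixes_pl_1[of l] by simp
    qed
  qed
  obtain w :: 'a where w: "w ^ 3 = 1" "w \<noteq> 1" using ex_primitive_cube_root[OF q3] by blast
  have w2: "(w\<^sup>2) ^ 3 = 1" using w(1) by (metis power_mult mult.commute power_one)
  have w0: "w \<noteq> 0" using w by auto
  have sw: "s w = w" "s (w\<^sup>2) = w\<^sup>2"
    using cube_root_fixed[OF _ q3] w(1) w2 by blast+
  have w2w: "w\<^sup>2 \<noteq> w" using w w0 by (simp add: power2_eq_square)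
  have "w\<^sup>2 \<noteq> 1"
  proof
    assume "w\<^sup>2 = 1"
    then have "w ^ 3 = w" by (simp add: power3_eq_cube power2_eq_square)
    with w show False by simp
  qed
  \<comment> \<open>The count is two because the primitive cube roots are exactly \<open>w\<close>
    and its square.\<close>
  have "{l. s l = l \<and> l ^ 3 = 1 \<and> l \<noteq> 1} = {w, w\<^sup>2}"
  proof
    have "l = w \<or> l = w\<^sup>2" if "l ^ 3 = 1" "l \<noteq> 1" for l
      using primitive_cube_roots[OF w that] by blast
    then show "{l. s l = l \<and> l ^ 3 = 1 \<and> l \<noteq> 1} \<subseteq> {w, w\<^sup>2}" by blast
    show "{w, w\<^sup>2} \<subseteq> {l. s l = l \<and> l ^ 3 = 1 \<and> l \<noteq> 1}"
      using sw w w2 \<open>w\<^sup>2 \<noteq> 1\<close> by simp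
  qed
  then have "?R = {pl 1 w, pl 1 (w\<^sup>2)}"
    by (simp add: pi_lam_eq_pl flip: s_eq)
  moreover have "pl 1 w \<noteq> pl 1 (w\<^sup>2)"
    using pl_1_eq_iff[OF sw w0] w0 w2w by simp
  ultimately show "card ?L = 2"
    unfolding eq by simp
qed

end

theorem theorem4p2:
  fixes p k q :: nat and F :: "'a::{field,finite} itself"
  assumes "prime p" and "k \<ge> 1" and "q = p ^ k" and "card (UNIV :: 'a set) = q ^ 3"
  shows "(gcd 3 (q - 1) = 1 \<longrightarrow>
            \<not> (\<exists>B \<in> (orbS q :: 'a vec3 set set set). Fq_plane q B \<and> mu_fixes q B))
       \<and> (gcd 3 (q - 1) = 3 \<longrightarrow>
            {B \<in> (orbS q :: 'a vec3 set set set). Fq_plane q B \<and> mu_fixes q B}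
              = {pi_lam q lam | lam :: 'a. lam ^ q = lam \<and> lam ^ 3 = 1 \<and> lam \<noteq> 1}
          \<and> card {B \<in> (orbS q :: 'a vec3 set set set). Fq_plane q B \<and> mu_fixes q B} = 2)"
proof -
  have char: "CHAR('a) = p"
    using CHAR_eq_if_card_eq_prime_power[OF assms(1), where 'a = 'a and n = "k * 3"] assms(3,4)
    by (simp add: power_mult)
  have q2: "2 \<le> q"
    using prime_ge_2_nat[OF assms(1)] self_le_power[of p k] assms(2,3) by simp
  \<comment> \<open>Additivity holds because \<open>q\<close> is a power of the characteristic; the
    third iterate is trivial because nonzero elements have order dividing
    \<open>q ^ 3 - 1\<close>.\<close>
  interpret cubic_frobenius q "\<lambda>x :: 'a. x ^ q"
  proof
    fix x y :: 'a
    show "(x + y) ^ q = x ^ q + y ^ q"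
      using freshmans_dream'[of q k x y] char assms(1,3) by simp
    have "((x ^ q) ^ q) ^ q = x ^ (q ^ 3)"
      by (simp add: power3_eq_cube mult.assoc flip: power_mult)
    also have "\<dots> = x"
    proof (cases "x = 0")
      case False
      have "x ^ (q ^ 3) = x * x ^ (q ^ 3 - 1)"
        using q2 by (simp flip: power_Suc)
      then show ?thesis
        using finite_field_power_card_minus_one[OF False] assms(4) by simp
    qed (use q2 in simp)
    finally show "((x ^ q) ^ q) ^ q = x" .
  qed (use q2 assms(4) in auto)
  show ?thesis
  proof (intro conjI impI)
    assume "gcd 3 (q - 1) = 1"
    then have "\<not> 3 dvd q - 1" by (auto elim!: dvdE)
    then show "\<not> (\<exists>B \<in> (orbS q :: 'a vec3 set set set). Fq_plane q B \<and> mu_fixes q B)"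
      by (rule no_fixed_plane)
  next
    assume "gcd 3 (q - 1) = 3"
    then have q3: "3 dvd q - 1" by (metis gcd_dvd2)
    show "{B \<in> (orbS q :: 'a vec3 set set set). Fq_plane q B \<and> mu_fixes q B}
        = {pi_lam q lam | lam :: 'a. lam ^ q = lam \<and> lam ^ 3 = 1 \<and> lam \<noteq> 1}"
      unfolding fixed_planes(1)[OF q3] by (rule setcompr_eq_image[symmetric])
    show "card {B \<in> (orbS q :: 'a vec3 set set set). Fq_plane q B \<and> mu_fixes q B} = 2"
      by (rule fixed_planes(2)[OF q3])
  qed
qed

end
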